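(* Let $(a,b)$ be a finite interval, let $q$ be a continuous complex valued function on $[a,b]$, and let $\lambda$ be an arbitrary complex number. Let $f\in C^{2}(a,b)\cap C^{1}[a,b]$ be a complex valued solution of $f''+qf=0$ on $(a,b)$ such that $f(x)\neq0$ for any $x\in[a,b]$, and suppose that at the point $x_{0}\in[a,b]$ there exist the derivatives of $f$ up to the $n$-th order ($n\ge1$). Let $u_1$ and $u_2$ be the linearly independent solutions of $$u''+qu=\lambda u$$ satisfying the initial conditions $$u_{1}(x_{0})=f(x_{0}),\quad u_{1}'(x_{0})=f'(x_{0}),\qquad u_{2}(x_{0})=0,\quad u_{2}'(x_{0})=1/f(x_{0}).$$ Then $u_1$ and $u_2$ possess at the point $x_{0}$ the derivatives up to the $n$-th order, which can be calculated according to the relations $$\begin{pmatrix} u_{1}(x_{0})/f(x_{0})\\ (u_{1}/f)'(x_{0})\\ (u_{1}/f)''(x_{0})\\ (u_{1}/f)'''(x_{0})\\ (u_{1}/f)^{IV}(x_{0})\\ \vdots\\ (u_{1}/f)^{[n]}(x_{0})\end{pmatrix}=A_{n}\begin{pmatrix}1\\0\\ \lambda\\0\\ \lambda^{2}\\ \vdots\\ \frac{1+(-1)^{n}}{2}\lambda^{\frac{n}{2}}\end{pmatrix} \qquad\text{and}\qquad \begin{pmatrix} u_{2}(x_{0})/f(x_{0})\\ (u_{2}/f)'(x_{0})\\ (u_{2}/f)''(x_{0})\\ (u_{2}/f)'''(x_{0})\\ (u_{2}/f)^{IV}(x_{0})\\ \vdots\\ (u_{2}/f)^{[n]}(x_{0})\end{pmatrix}=A_{n}\begin{pmatrix}0\\1\\0\\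 \lambda\\0\\ \vdots\\ \frac{1+(-1)^{n+1}}{2}\lambda^{\frac{n-1}{2}}\end{pmatrix},$$ where $A_{n}$ is the $(n+1)\times(n+1)$ matrix, depending only on the derivatives of $f$ at $x_0$, defined in the context.
   Context: $g^{[k]}$ denotes the ordinary $k$-th derivative of $g$; derivatives at end points of $[a,b]$ are one-sided. The column vectors have entries indexed by $k=0,\ldots,n$: the $k$-th entry of the first is $\lambda^{k/2}$ for even $k$ and $0$ for odd $k$; the $k$-th entry of the second is $\lambda^{(k-1)/2}$ for odd $k$ and $0$ for even $k$ (with $\lambda^0=1$). Put $\varphi=f^2$. The matrix $A_n=(a_{j,m}(x_0))_{0\le j,m\le n}$ is the lower triangular matrix whose entries are the values at $x_0$ of the functions determined by $a_{0,0}=1$, $a_{j,0}=0$ for $j\geq1$, $a_{j,m}=0$ for $m>j$, and the recursion $$a_{j,m}=a_{j-1,m}'+\varphi^{(-1)^{m}}a_{j-1,m-1},\qquad 1\le m\le j\le n .$$ In particular $a_{1,1}=1/\varphi$, $a_{2,1}=(1/\varphi)'$, and the diagonal entries $a_{j,j}$ are $1/\varphi(x_0)$ for odd $j$ and $1$ for even $j$; the entries involve only derivatives of $\varphi$ of order at most $n-1$. *)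

theory Defs
  imports "HOL-Analysis.Analysis" "Jordan_Normal_Form.Matrix"
begin

(* All derivatives are relative to a set S of reals: for an interior point of S this is the
   ordinary derivative, for S = {a..b} and x = a or x = b it is the one-sided one.
   (The library's deriv does not apply to functions from the reals to the complex numbers.)
   Where the derivative does not exist the value of iter_deriv is unspecified; existence is
   expressed by C_k_on and has_derivs_upto below. *)

primrec iter_deriv :: "real set \<Rightarrow> nat \<Rightarrow> (real \<Rightarrow> complex) \<Rightarrow> real \<Rightarrow> complex" where
  "iter_deriv S 0 g = g"
| "iter_deriv S (Suc k) g = (\<lambda>x. vector_derivative (iter_deriv S k g) (at x within S))"

definition C_k_on :: "nat \<Rightarrow> real set \<Rightarrow> (real \<Rightarrow> complex) \<Rightarrow> bool" where
  "C_k_on k S g \<longleftrightarrow>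
     (\<forall>i<k. \<forall>x\<in>S. iter_deriv S i g differentiable (at x within S)) \<and>
     (\<forall>i\<le>k. continuous_on S (iter_deriv S i g))"

(* Existence at the single point x0 of the derivatives up to order n: those of order less than n
   have to exist in a (relative) neighbourhood of x0, the n-th one only at x0 itself. *)

definition has_derivs_upto :: "real set \<Rightarrow> nat \<Rightarrow> (real \<Rightarrow> complex) \<Rightarrow> real \<Rightarrow> bool" where
  "has_derivs_upto S n g x0 \<longleftrightarrow>
     (\<forall>k<n. iter_deriv S k g differentiable (at x0 within S) \<and>
        (Suc k < n \<longrightarrow>
          (\<forall>\<^sub>F x in at x0 within S. iter_deriv S k g differentiable (at x within S))))"

definition is_solution ::
  "real \<Rightarrow> real \<Rightarrow> (real \<Rightarrow> complex) \<Rightarrow> complex \<Rightarrow> (real \<Rightarrow> complex) \<Rightarrow> bool" where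
  "is_solution a b q \<mu> u \<longleftrightarrow>
     C_k_on 2 {a<..<b} u \<and> C_k_on 1 {a..b} u \<and>
     (\<forall>x\<in>{a<..<b}. iter_deriv {a<..<b} 2 u x + q x * u x = \<mu> * u x)"

fun a_fun :: "real set \<Rightarrow> (real \<Rightarrow> complex) \<Rightarrow> nat \<Rightarrow> nat \<Rightarrow> real \<Rightarrow> complex" where
  "a_fun S \<phi> 0 m = (\<lambda>x. if m = 0 then 1 else 0)"
| "a_fun S \<phi> (Suc j) 0 = (\<lambda>x. 0)"
| "a_fun S \<phi> (Suc j) (Suc m) =
     (if Suc m > Suc j then (\<lambda>x. 0)
      else (\<lambda>x. vector_derivative (a_fun S \<phi> j (Suc m)) (at x within S)
                 + \<phi> x powi ((- 1) ^ Suc m) * a_fun S \<phi> j m x))"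

definition A_mat :: "real set \<Rightarrow> (real \<Rightarrow> complex) \<Rightarrow> real \<Rightarrow> nat \<Rightarrow> complex mat" where
  "A_mat S f x0 n =
     mat (n + 1) (n + 1) (\<lambda>(j, m). a_fun S (\<lambda>x. (f x)\<^sup>2) j m x0)"

definition deriv_vec :: "real set \<Rightarrow> (real \<Rightarrow> complex) \<Rightarrow> real \<Rightarrow> nat \<Rightarrow> complex vec" where
  "deriv_vec S g x0 n = vec (n + 1) (\<lambda>k. iter_deriv S k g x0)"

end

theory Submission
  imports Defs
begin

text \<open>
  Put \<open>\<phi> = f\<^sup>2\<close>, \<open>v = u / f\<close> and let \<open>w = u' f - u f'\<close> be the Wronskian of \<open>f\<close> and \<open>u\<close>.  Since
  \<open>f'' = - q f\<close> and \<open>u'' = (\<lambda> - q) u\<close>, the potential cancels and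
  \<open>v' = w / \<phi>\<close>, \<open>w' = \<lambda> \<phi> v\<close>.
  In this first-order system only \<open>\<phi>\<close> occurs, and no derivative of \<open>q\<close> is ever formed.  The equation
  for \<open>w'\<close> is first known in the open interval; as its right-hand side is continuous on the closed
  one, it persists at the end points (lemmas \<open>has_vector_derivative_Icc\<close> and
  \<open>quotient_wronskian_system\<close>).  Every derivative of \<open>v\<close> or \<open>w\<close> brings back the other
  function with a factor made of \<open>\<phi>\<close>, so both functions have at least as many derivatives at \<open>x\<^sub>0\<close> as \<open>\<phi>\<close>
  (lemma \<open>has_derivs_upto_system\<close>).

  For the values, arrange the system as an infinite chain
  \<open>Z\<^sub>0, Z\<^sub>1, Z\<^sub>2, \<dots> = v, w, \<lambda> v, \<lambda> w, \<lambda>\<^sup>2 v, \<dots>\<close>, in which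
  \<open>Z\<^sub>m' = \<phi>\<^sup>\<plusminus>\<^sup>1 Z\<^sub>m\<^sub>+\<^sub>1\<close> with the sign alternating.  Differentiating
  \<open>v\<^sup>(\<^sup>j\<^sup>) = \<Sum> a\<^sub>j\<^sub>,\<^sub>m Z\<^sub>m\<close> once more by the product rule gives precisely the recursion
  that defines the entries of the matrix (lemma \<open>iter_deriv_chain\<close>).  The two columns of the theorem
  are the values of the chain at \<open>x\<^sub>0\<close>: the initial conditions mean \<open>(v, w)(x\<^sub>0) = (1, 0)\<close> for \<open>u\<^sub>1\<close>
  and \<open>(0, 1)\<close> for \<open>u\<^sub>2\<close>.
\<close>

section \<open>Functions with finitely many derivatives at a point\<close>

text \<open>
  Without isolated points in \<open>S\<close> the derivative relative to \<open>S\<close> is unique, hence equal to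
  the value chosen by \<open>vector_derivative\<close>.
\<close>

locale no_isolated_points =
  fixes S :: "real set"
  assumes at_within_neq_bot: "x \<in> S \<Longrightarrow> at x within S \<noteq> bot"
begin

lemma vector_derivative_eqI:
  "(g has_vector_derivative d) (at x within S) \<Longrightarrow> x \<in> S \<Longrightarrow>
    vector_derivative g (at x within S) = d"
  by (rule vector_derivative_within[OF at_within_neq_bot])

end

lemma iter_deriv_Suc_inner:
  "iter_deriv S (Suc k) g = iter_deriv S k (\<lambda>x. vector_derivative g (at x within S))"
proof (induction k)
  case (Suc k)
  then show ?case
    by (metis iter_deriv.simps(2))
qed simp

lemma eventually_nhds_at_within:
  assumes "P x0"
  shows "(\<forall>\<^sub>F x in at x0 within S. P x) \<longleftrightarrow> (\<forall>\<^sub>F x in nhds x0. x \<in> S \<longrightarrow> P x)"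
  unfolding eventually_at_filter using assms
  by (auto elim!: eventually_mono)

text \<open>
  This unfolding along the first derivative makes the closure properties below provable by
  induction on the order.
\<close>

lemma has_derivs_upto_Suc_iff:
  "has_derivs_upto S (Suc n) g x0 \<longleftrightarrow>
     g differentiable (at x0 within S) \<and>
     (0 < n \<longrightarrow> (\<forall>\<^sub>F x in nhds x0. x \<in> S \<longrightarrow> g differentiable (at x within S))) \<and>
     has_derivs_upto S n (\<lambda>x. vector_derivative g (at x within S)) x0"
  (is "?L \<longleftrightarrow> ?R")
proof -
  have near: "(\<forall>\<^sub>F x in at x0 within S. g differentiable (at x within S)) \<longleftrightarrow>
      (\<forall>\<^sub>F x in nhds x0. x \<in> S \<longrightarrow> g differentiable (at x within S))"
    if "g differentiable (at x0 within S)"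
    using that by (rule eventually_nhds_at_within)
  show ?thesis
    unfolding has_derivs_upto_def All_less_Suc2 iter_deriv_Suc_inner
    using near by auto
qed

lemma has_derivs_upto_0 [simp]: "has_derivs_upto S 0 g x0"
  by (simp add: has_derivs_upto_def)

lemma has_derivs_upto_mono:
  "has_derivs_upto S n g x0 \<Longrightarrow> m \<le> n \<Longrightarrow> has_derivs_upto S m g x0"
  by (auto simp: has_derivs_upto_def)

lemma has_derivs_upto_cong:
  assumes "\<forall>\<^sub>F x in nhds x0. x \<in> S \<longrightarrow> g x = h x" and "x0 \<in> S"
    and "has_derivs_upto S n g x0"
  shows "has_derivs_upto S n h x0"
  using assms
proof (induction n arbitrary: g h)
  case (Suc n)
  have transfer: "x \<in> S \<longrightarrow> (g differentiable (at x within S) \<longleftrightarrow> h differentiable (at x within S)) \<and>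
      vector_derivative g (at x within S) = vector_derivative h (at x within S)"
    if "\<forall>\<^sub>F y in nhds x. y \<in> S \<longrightarrow> g y = h y" for x
  proof (intro impI conjI)
    assume "x \<in> S"
    with that have "g x = h x"
      using eventually_nhds_x_imp_x by fastforce
    then have "(g has_vector_derivative d) (at x within S) \<longleftrightarrow>
        (h has_vector_derivative d) (at x within S)" for d
      by (rule has_vector_derivative_cong_ev[OF that])
    then show "g differentiable (at x within S) \<longleftrightarrow> h differentiable (at x within S)"
      by (metis differentiableI_vector vector_derivative_works)
    show "vector_derivative g (at x within S) = vector_derivative h (at x within S)"
      using that \<open>x \<in> S\<close> by (intro vector_derivative_cong_eq) auto
  qed
  have "\<forall>\<^sub>F x in nhds x0. x \<in> S \<longrightarrow>
      (g differentiable (at x within S) \<longleftrightarrow> h differentiable (at x within S)) \<and>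
      vector_derivative g (at x within S) = vector_derivative h (at x within S)"
    using Suc.prems(1)[THEN eventually_eventually[THEN iffD2]]
    by eventually_elim (rule transfer)
  then have diff: "\<forall>\<^sub>F x in nhds x0. x \<in> S \<longrightarrow>
        g differentiable (at x within S) \<longrightarrow> h differentiable (at x within S)"
    and eq: "\<forall>\<^sub>F x in nhds x0. x \<in> S \<longrightarrow>
        vector_derivative g (at x within S) = vector_derivative h (at x within S)"
    by (auto elim: eventually_mono)
  note g = Suc.prems(3)[unfolded has_derivs_upto_Suc_iff]
  have "\<forall>\<^sub>F x in nhds x0. x \<in> S \<longrightarrow> h differentiable (at x within S)" if "0 < n"
    using diff g[THEN conjunct2, THEN conjunct1, rule_format, OF that]
    by eventually_elim auto
  moreover have "has_derivs_upto S n (\<lambda>x. vector_derivative h (at x within S)) x0"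
    using Suc.IH[OF eq Suc.prems(2)] g by blast
  ultimately show ?case
    using transfer[OF Suc.prems(1)] Suc.prems(2) g by (auto simp: has_derivs_upto_Suc_iff)
qed simp

lemma has_derivs_upto_Suc_has_vector_derivative:
  assumes "has_derivs_upto S (Suc n) g x0"
  defines "g' \<equiv> \<lambda>x. vector_derivative g (at x within S)"
  shows "(g has_vector_derivative g' x0) (at x0 within S)"
    and "0 < n \<Longrightarrow>
      \<forall>\<^sub>F x in nhds x0. x \<in> S \<longrightarrow> (g has_vector_derivative g' x) (at x within S)"
    and "has_derivs_upto S n g' x0"
  using assms by (auto simp: has_derivs_upto_Suc_iff vector_derivative_works)

context no_isolated_points
begin

text \<open>
  The hypothesis in a neighbourhood is restricted to \<open>0 < n\<close>, because the derivative of top order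
  need exist at \<open>x0\<close> only.
\<close>

lemma has_derivs_upto_SucI:
  assumes "x0 \<in> S"
    and at: "(g has_vector_derivative g' x0) (at x0 within S)"
    and near: "0 < n \<Longrightarrow>
      \<forall>\<^sub>F x in nhds x0. x \<in> S \<longrightarrow> (g has_vector_derivative g' x) (at x within S)"
    and "has_derivs_upto S n g' x0"
  shows "has_derivs_upto S (Suc n) g x0"
proof -
  have "has_derivs_upto S n (\<lambda>x. vector_derivative g (at x within S)) x0"
  proof (cases "n = 0")
    case False
    then have "\<forall>\<^sub>F x in nhds x0. x \<in> S \<longrightarrow> g' x = vector_derivative g (at x within S)"
      using near by (auto elim!: eventually_mono simp: vector_derivative_eqI)
    then show ?thesis
      using assms by (blast intro: has_derivs_upto_cong)
  qed simp
  moreover have "\<forall>\<^sub>F x in nhds x0. x \<in> S \<longrightarrow> g differentiable (at x within S)" if "0 < n"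
    using near[OF that] by eventually_elim (auto intro: differentiableI_vector)
  ultimately show ?thesis
    using at by (auto simp: has_derivs_upto_Suc_iff intro: differentiableI_vector)
qed

lemma has_derivs_upto_const [simp]:
  assumes "x0 \<in> S"
  shows "has_derivs_upto S n (\<lambda>x. c) x0"
proof (induction n arbitrary: c)
  case (Suc n)
  show ?case
    using Suc by (intro has_derivs_upto_SucI[where g' = "\<lambda>x. 0"] assms) auto
qed simp

lemma has_derivs_upto_add:
  assumes "x0 \<in> S" and "has_derivs_upto S n g x0" and "has_derivs_upto S n h x0"
  shows "has_derivs_upto S n (\<lambda>x. g x + h x) x0"
  using assms(2,3)
proof (induction n arbitrary: g h)
  case (Suc n)
  note g = has_derivs_upto_Suc_has_vector_derivative[OF Suc.prems(1)]
    and h = has_derivs_upto_Suc_has_vector_derivative[OF Suc.prems(2)]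
  show ?case
  proof (rule has_derivs_upto_SucI[OF assms(1)])
    show "has_derivs_upto S n (\<lambda>x. vector_derivative g (at x within S) +
        vector_derivative h (at x within S)) x0"
      by (rule Suc.IH[OF g(3) h(3)])
    show "\<forall>\<^sub>F x in nhds x0. x \<in> S \<longrightarrow>
        ((\<lambda>x. g x + h x) has_vector_derivative vector_derivative g (at x within S) +
          vector_derivative h (at x within S)) (at x within S)" if "0 < n"
      using g(2)[OF that] h(2)[OF that]
      by eventually_elim (auto intro: has_vector_derivative_add)
  qed (intro has_vector_derivative_add g h)
qed simp

lemma has_derivs_upto_mult:
  assumes "x0 \<in> S" and "has_derivs_upto S n g x0" and "has_derivs_upto S n h x0"
  shows "has_derivs_upto S n (\<lambda>x. g x * h x) x0"
  using assms(2,3)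
proof (induction n arbitrary: g h)
  case (Suc n)
  note g = has_derivs_upto_Suc_has_vector_derivative[OF Suc.prems(1)]
    and h = has_derivs_upto_Suc_has_vector_derivative[OF Suc.prems(2)]
  have "has_derivs_upto S n g x0" "has_derivs_upto S n h x0"
    using Suc.prems by (auto elim: has_derivs_upto_mono)
  show ?case
  proof (rule has_derivs_upto_SucI[OF assms(1)])
    show "has_derivs_upto S n (\<lambda>x. g x * vector_derivative h (at x within S) +
        vector_derivative g (at x within S) * h x) x0"
      by (intro has_derivs_upto_add Suc.IH assms g h) fact+
    show "\<forall>\<^sub>F x in nhds x0. x \<in> S \<longrightarrow>
        ((\<lambda>x. g x * h x) has_vector_derivative g x * vector_derivative h (at x within S) +
          vector_derivative g (at x within S) * h x) (at x within S)" if "0 < n"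
      using g(2)[OF that] h(2)[OF that]
      by eventually_elim (auto intro: has_vector_derivative_mult)
  qed (intro has_vector_derivative_mult g h)
qed simp

end

lemma has_vector_derivative_inverse_within:
  fixes g :: "real \<Rightarrow> complex"
  assumes "(g has_vector_derivative d) (at x within S)" and "g x \<noteq> 0"
  shows "((\<lambda>x. inverse (g x)) has_vector_derivative - d * (inverse (g x) * inverse (g x)))
    (at x within S)"
proof -
  have "((inverse \<circ> g) has_vector_derivative d * - (inverse (g x) * inverse (g x))) (at x within S)"
    using DERIV_inverse'[OF DERIV_ident assms(2)]
    by (intro field_vector_diff_chain_within assms(1)) (auto intro: has_field_derivative_at_within)
  then show ?thesis
    by (simp add: o_def)
qed

lemma (in no_isolated_points) has_derivs_upto_inverse:
  assumes "x0 \<in> S" and nz: "\<And>x. x \<in> S \<Longrightarrow> g x \<noteq> 0" and "has_derivs_upto S n g x0"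
  shows "has_derivs_upto S n (\<lambda>x. inverse (g x)) x0"
  using assms(3)
proof (induction n)
  case (Suc n)
  let ?g' = "\<lambda>x. vector_derivative g (at x within S)"
  note g = has_derivs_upto_Suc_has_vector_derivative[OF Suc.prems]
  have "has_derivs_upto S n (\<lambda>x. inverse (g x)) x0"
    using Suc.IH has_derivs_upto_mono[OF Suc.prems] by simp
  then have "has_derivs_upto S n (\<lambda>x. (-1) * ?g' x * (inverse (g x) * inverse (g x))) x0"
    by (intro has_derivs_upto_mult has_derivs_upto_const assms g)
  moreover have "\<forall>\<^sub>F x in nhds x0. x \<in> S \<longrightarrow> ((\<lambda>x. inverse (g x)) has_vector_derivative
      - ?g' x * (inverse (g x) * inverse (g x))) (at x within S)" if "0 < n"
    using g(2)[OF that] by eventually_elim (intro impI has_vector_derivative_inverse_within nz; simp)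
  ultimately show ?case
    using has_vector_derivative_inverse_within[OF g(1) nz] assms(1)
    by (intro has_derivs_upto_SucI[where
          g' = "\<lambda>x. - ?g' x * (inverse (g x) * inverse (g x))"]) auto
qed simp

section \<open>The coefficients and the chain of alternating derivatives\<close>

context no_isolated_points
begin

lemma a_fun_above_diagonal: "j < m \<Longrightarrow> a_fun S \<phi> j m = (\<lambda>x. 0)"
  by (cases "(S, \<phi>, j, m)" rule: a_fun.cases) auto

text \<open>
  The recursion also holds above the diagonal, where both sides vanish; this allows sums over a
  fixed range of columns.
\<close>

lemma a_fun_Suc_Suc:
  assumes "x \<in> S"
  shows "a_fun S \<phi> (Suc j) (Suc m) x =
    vector_derivative (a_fun S \<phi> j (Suc m)) (at x within S) +
    \<phi> x powi ((- 1) ^ Suc m) * a_fun S \<phi> j m x"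
  using assms by (simp add: a_fun_above_diagonal
      vector_derivative_eqI[OF has_vector_derivative_const])

lemma vector_derivative_a_fun_0:
  assumes "x \<in> S"
  shows "vector_derivative (a_fun S \<phi> j 0) (at x within S) = 0"
  using assms by (cases j) (auto intro!: vector_derivative_eqI)

lemma has_derivs_upto_a_fun:
  assumes "x0 \<in> S" and nz: "\<And>x. x \<in> S \<Longrightarrow> \<phi> x \<noteq> 0" and \<phi>: "has_derivs_upto S n \<phi> x0"
  shows "has_derivs_upto S (n - j) (a_fun S \<phi> j m) x0"
proof (induction j arbitrary: m)
  case 0
  show ?case
    using assms(1) by simp
next
  case (Suc j)
  show ?case
  proof (cases "j < n")
    case True
    then have order: "n - j = Suc (n - Suc j)"
      by simp
    show ?thesis
    proof (cases m)
      case 0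
      then show ?thesis
        using assms(1) by simp
    next
      case (Suc l)
      have "(- 1) ^ Suc l = (1 :: int) \<or> (- 1) ^ Suc l = (- 1 :: int)"
        by (cases "even l") auto
      then have "has_derivs_upto S n (\<lambda>x. \<phi> x powi ((- 1) ^ Suc l)) x0"
        using \<phi> has_derivs_upto_inverse[OF assms(1) nz \<phi>]
        by (elim disjE) (simp_all add: power_int_minus)
      then have "has_derivs_upto S (n - Suc j) (\<lambda>x. \<phi> x powi ((- 1) ^ Suc l)) x0"
        by (rule has_derivs_upto_mono) simp
      moreover have "has_derivs_upto S (n - Suc j) (a_fun S \<phi> j l) x0"
        using Suc.IH by (rule has_derivs_upto_mono) simp
      moreover have "has_derivs_upto S (n - Suc j)
          (\<lambda>x. vector_derivative (a_fun S \<phi> j (Suc l)) (at x within S)) x0"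
        using Suc.IH[of "Suc l"] unfolding order has_derivs_upto_Suc_iff by blast
      ultimately have rhs: "has_derivs_upto S (n - Suc j)
          (\<lambda>x. vector_derivative (a_fun S \<phi> j (Suc l)) (at x within S) +
            \<phi> x powi ((- 1) ^ Suc l) * a_fun S \<phi> j l x) x0"
        by (intro has_derivs_upto_add has_derivs_upto_mult assms(1))
      show ?thesis
        unfolding Suc
        by (rule has_derivs_upto_cong[OF _ assms(1) rhs])
          (intro always_eventually allI impI a_fun_Suc_Suc[symmetric])
    qed
  qed simp
qed

text \<open>
  The product rule, with the terms that contain \<open>Z (Suc m)\<close> collected under the same index as
  the derivatives of the coefficients one column further, is the recursion of the coefficients.
  No term is lost at the upper end, because the coefficient in column \<open>Suc N\<close> is still zero for
  \<open>j \<le> N\<close>.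
\<close>

lemma has_vector_derivative_chain_sum:
  assumes "x \<in> S" and "j \<le> N"
    and Z: "\<And>m. (Z m has_vector_derivative \<phi> x powi ((- 1) ^ Suc m) * Z (Suc m) x) (at x within S)"
    and diff: "\<And>m. a_fun S \<phi> j m differentiable (at x within S)"
  shows "((\<lambda>y. \<Sum>m\<le>Suc N. a_fun S \<phi> j m y * Z m y) has_vector_derivative
    (\<Sum>m\<le>Suc N. a_fun S \<phi> (Suc j) m x * Z m x)) (at x within S)"
proof -
  let ?p = "\<lambda>m. \<phi> x powi ((- 1) ^ Suc m)"
  let ?a' = "\<lambda>m. vector_derivative (a_fun S \<phi> j m) (at x within S)"
  have "((\<lambda>y. \<Sum>m\<le>Suc N. a_fun S \<phi> j m y * Z m y) has_vector_derivative
      (\<Sum>m\<le>Suc N. a_fun S \<phi> j m x * (?p m * Z (Suc m) x) + ?a' m * Z m x)) (at x within S)"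
    by (intro has_vector_derivative_sum has_vector_derivative_mult Z
        vector_derivative_works[THEN iffD1] diff)
  also have "(\<Sum>m\<le>Suc N. a_fun S \<phi> j m x * (?p m * Z (Suc m) x) + ?a' m * Z m x) =
      (\<Sum>m\<le>Suc N. a_fun S \<phi> j m x * (?p m * Z (Suc m) x)) + (\<Sum>m\<le>Suc N. ?a' m * Z m x)"
    by (rule sum.distrib)
  also have "(\<Sum>m\<le>Suc N. a_fun S \<phi> j m x * (?p m * Z (Suc m) x)) =
      (\<Sum>m\<le>N. a_fun S \<phi> j m x * (?p m * Z (Suc m) x))"
    using \<open>j \<le> N\<close> by (simp add: a_fun_above_diagonal)
  also have "(\<Sum>m\<le>Suc N. ?a' m * Z m x) = (\<Sum>m\<le>N. ?a' (Suc m) * Z (Suc m) x)"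
    by (simp only: sum.atMost_Suc_shift vector_derivative_a_fun_0[OF \<open>x \<in> S\<close>] mult_zero_left
        add_0)
  also have "(\<Sum>m\<le>N. a_fun S \<phi> j m x * (?p m * Z (Suc m) x)) + \<dots> =
      (\<Sum>m\<le>N. a_fun S \<phi> (Suc j) (Suc m) x * Z (Suc m) x)"
    unfolding a_fun_Suc_Suc[OF \<open>x \<in> S\<close>] by (simp add: sum.distrib algebra_simps)
  also have "\<dots> = (\<Sum>m\<le>Suc N. a_fun S \<phi> (Suc j) m x * Z m x)"
    by (simp only: sum.atMost_Suc_shift a_fun.simps(2) mult_zero_left add_0)
  finally show ?thesis .
qed

text \<open>
  The identity is needed in a neighbourhood of \<open>x0\<close> to be differentiated again; for \<open>j = n\<close>
  it remains at \<open>x0\<close> only.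
\<close>

lemma iter_deriv_chain:
  assumes "x0 \<in> S" and nz: "\<And>x. x \<in> S \<Longrightarrow> \<phi> x \<noteq> 0" and \<phi>: "has_derivs_upto S n \<phi> x0"
    and Z: "\<And>m x. x \<in> S \<Longrightarrow>
      (Z m has_vector_derivative \<phi> x powi ((- 1) ^ Suc m) * Z (Suc m) x) (at x within S)"
    and "j \<le> n"
  shows "iter_deriv S j (Z 0) x0 = (\<Sum>m\<le>n. a_fun S \<phi> j m x0 * Z m x0)" (is "?eq j x0")
proof -
  have "?eq j x0 \<and> (j < n \<longrightarrow> (\<forall>\<^sub>F x in nhds x0. x \<in> S \<longrightarrow> ?eq j x))"
    using \<open>j \<le> n\<close>
  proof (induction j)
    case 0
    have "(\<Sum>m\<le>n. a_fun S \<phi> 0 m x * Z m x) = Z 0 x" for x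
      by (simp add: if_distrib[of "\<lambda>c. c * _"] sum.delta cong: if_cong)
    then show ?case
      by simp
  next
    case (Suc j)
    then obtain N where N: "n = Suc N" "j \<le> N"
      by (cases n) auto
    have step: "?eq (Suc j) x"
      if "x \<in> S" and near: "\<forall>\<^sub>F y in nhds x. y \<in> S \<longrightarrow> ?eq j y"
        and diff: "\<And>m. a_fun S \<phi> j m differentiable (at x within S)" for x
    proof -
      have "iter_deriv S (Suc j) (Z 0) x =
          vector_derivative (\<lambda>y. \<Sum>m\<le>n. a_fun S \<phi> j m y * Z m y) (at x within S)"
        using vector_derivative_cong_eq[OF near refl refl \<open>x \<in> S\<close>] by simp
      also have "\<dots> = (\<Sum>m\<le>n. a_fun S \<phi> (Suc j) m x * Z m x)"
        unfolding N(1)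
        by (intro vector_derivative_eqI has_vector_derivative_chain_sum Z that N(2))
      finally show ?thesis .
    qed
    have order: "n - j = Suc (n - Suc j)"
      using Suc.prems by simp
    note a = has_derivs_upto_a_fun[OF assms(1) nz \<phi>, of j, unfolded order has_derivs_upto_Suc_iff]
    have near: "\<forall>\<^sub>F x in nhds x0. x \<in> S \<longrightarrow> ?eq j x"
      using Suc by auto
    have "\<forall>\<^sub>F x in nhds x0. x \<in> S \<longrightarrow> ?eq (Suc j) x" if "Suc j < n"
    proof -
      \<comment> \<open>Only finitely many columns matter, so one neighbourhood serves them all.\<close>
      have "\<forall>\<^sub>F x in nhds x0. \<forall>m\<in>{..j}. x \<in> S \<longrightarrow> a_fun S \<phi> j m differentiable (at x within S)"
        using a that by (intro eventually_ball_finite) auto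
      with near[THEN eventually_eventually[THEN iffD2]] show ?thesis
      proof eventually_elim
        case (elim x)
        show ?case
        proof
          assume "x \<in> S"
          show "?eq (Suc j) x"
          proof (rule step[OF \<open>x \<in> S\<close> elim(1)])
            show "a_fun S \<phi> j m differentiable (at x within S)" for m
              using elim(2) \<open>x \<in> S\<close> by (cases "m \<le> j") (auto simp: a_fun_above_diagonal)
          qed
        qed
      qed
    qed
    with step[OF assms(1) near] a show ?case
      by blast
  qed
  then show ?thesis ..
qed

text \<open>
  Each order is gained for \<open>v\<close> and \<open>w\<close> together, since the derivative of either one contains the
  other.
\<close>

lemma has_derivs_upto_system:
  assumes "x0 \<in> S" and nz: "\<And>x. x \<in> S \<Longrightarrow> \<phi> x \<noteq> 0" and \<phi>: "has_derivs_upto S n \<phi> x0"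
    and v: "\<And>x. x \<in> S \<Longrightarrow> (v has_vector_derivative inverse (\<phi> x) * w x) (at x within S)"
    and w: "\<And>x. x \<in> S \<Longrightarrow> (w has_vector_derivative c * (\<phi> x * v x)) (at x within S)"
  shows "has_derivs_upto S n v x0" and "has_derivs_upto S n w x0"
proof -
  have "has_derivs_upto S k v x0 \<and> has_derivs_upto S k w x0" if "k \<le> n" for k
    using that
  proof (induction k)
    case (Suc k)
    have "has_derivs_upto S k \<phi> x0"
      using \<phi> Suc.prems by (auto elim: has_derivs_upto_mono)
    then have "has_derivs_upto S k (\<lambda>x. inverse (\<phi> x) * w x) x0"
      and "has_derivs_upto S k (\<lambda>x. c * (\<phi> x * v x)) x0"
      using Suc by (intro has_derivs_upto_mult has_derivs_upto_inverse has_derivs_upto_const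
          assms(1) nz; simp)+
    then show ?case
      by (intro conjI has_derivs_upto_SucI[OF assms(1), where g' = "\<lambda>x. inverse (\<phi> x) * w x"]
          has_derivs_upto_SucI[OF assms(1), where g = w and g' = "\<lambda>x. c * (\<phi> x * v x)"]
          always_eventually allI impI v w assms(1))
  qed simp
  then show "has_derivs_upto S n v x0" and "has_derivs_upto S n w x0"
    by auto
qed

end

section \<open>From the second-order equation to a first-order system\<close>

lemma no_isolated_points_Icc:
  assumes "a < b"
  shows "no_isolated_points {a..b}"
proof
  show "at x within {a..b} \<noteq> bot" if "x \<in> {a..b}" for x
    using that assms by (simp add: trivial_limit_within)
qed

text \<open>
  A derivative that extends continuously to the end points is the one-sided derivative there:
  \<open>W\<close> is an indefinite integral of its continuous derivative on the whole closed interval.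
\<close>

lemma has_vector_derivative_Icc:
  fixes W :: "real \<Rightarrow> 'a::banach"
  assumes W: "continuous_on {a..b} W" and G: "continuous_on {a..b} G"
    and deriv: "\<And>x. x \<in> {a<..<b} \<Longrightarrow> (W has_vector_derivative G x) (at x)"
    and x: "x \<in> {a..b}"
  shows "(W has_vector_derivative G x) (at x within {a..b})"
proof -
  have W_eq: "W y = W a + integral {a..y} G" if "y \<in> {a..b}" for y
  proof -
    have "(G has_integral (W y - W a)) {a..y}"
      using that by (intro fundamental_theorem_of_calculus_interior deriv
          continuous_on_subset[OF W]) auto
    then show ?thesis
      by (simp add: integral_unique)
  qed
  have "((\<lambda>y. W a + integral {a..y} G) has_vector_derivative G x) (at x within {a..b})"
    using has_vector_derivative_add[OF has_vector_derivative_const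
        integral_has_vector_derivative[OF G x]] by simp
  with x W_eq show ?thesis
    by (rule has_vector_derivative_transform)
qed

lemma C_1_on_Icc:
  assumes "C_k_on 1 {a..b} u"
  shows "continuous_on {a..b} u" and "continuous_on {a..b} (iter_deriv {a..b} 1 u)"
    and "x \<in> {a..b} \<Longrightarrow> (u has_vector_derivative iter_deriv {a..b} 1 u x) (at x within {a..b})"
proof -
  have *: "(\<forall>x\<in>{a..b}. u differentiable (at x within {a..b})) \<and>
      (\<forall>i\<le>1. continuous_on {a..b} (iter_deriv {a..b} i u))"
    using assms by (simp add: C_k_on_def)
  show "x \<in> {a..b} \<Longrightarrow> (u has_vector_derivative iter_deriv {a..b} 1 u x) (at x within {a..b})"
    using * by (simp add: vector_derivative_works)
  show "continuous_on {a..b} u" and "continuous_on {a..b} (iter_deriv {a..b} 1 u)"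
    using *[THEN conjunct2, rule_format, of 0] *[THEN conjunct2, rule_format, of 1] by simp_all
qed

text \<open>
  The derivatives relative to the open and to the closed interval agree in the interior, which
  links the two smoothness classes in the notion of a solution.
\<close>

lemma is_solution_second_derivative:
  assumes "is_solution a b q \<mu> u" and x: "x \<in> {a<..<b}"
  shows "(iter_deriv {a..b} 1 u has_vector_derivative (\<mu> - q x) * u x) (at x)"
proof -
  let ?I = "{a<..<b}"
  have at_I: "at y within ?I = at y" "at y within {a..b} = at y" if "y \<in> ?I" for y
    using that by (auto intro: at_within_open at_within_Icc_at)
  have "C_k_on 2 ?I u"
    using assms(1) unfolding is_solution_def by blast
  then have "iter_deriv ?I 1 u differentiable (at x within ?I)"
    unfolding C_k_on_def using x by (elim conjE allE[where x = 1]) simp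
  moreover have "iter_deriv ?I 2 u x = (\<mu> - q x) * u x"
    using assms by (auto simp: is_solution_def algebra_simps)
  ultimately have "(iter_deriv ?I 1 u has_vector_derivative (\<mu> - q x) * u x) (at x within ?I)"
    by (simp add: vector_derivative_works numeral_2_eq_2)
  then have "(iter_deriv {a..b} 1 u has_vector_derivative (\<mu> - q x) * u x) (at x within ?I)"
    by (rule has_vector_derivative_transform[OF x, rotated]) (simp add: at_I)
  then show ?thesis
    using x by (simp add: at_I)
qed

lemma quotient_wronskian_system:
  fixes a b :: real and q f u :: "real \<Rightarrow> complex" and lam :: complex
  assumes f: "is_solution a b q 0 f" and nz: "\<forall>x\<in>{a..b}. f x \<noteq> 0"
    and u: "is_solution a b q lam u" and x: "x \<in> {a..b}"
  defines "v \<equiv> \<lambda>x. u x / f x"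
    and "w \<equiv> \<lambda>x. iter_deriv {a..b} 1 u x * f x - u x * iter_deriv {a..b} 1 f x"
  shows "(v has_vector_derivative inverse ((f x)\<^sup>2) * w x) (at x within {a..b})"
    and "(w has_vector_derivative lam * ((f x)\<^sup>2 * v x)) (at x within {a..b})"
proof -
  let ?f' = "iter_deriv {a..b} 1 f" and ?u' = "iter_deriv {a..b} 1 u"
  have "C_k_on 1 {a..b} f" "C_k_on 1 {a..b} u"
    using f u by (auto simp: is_solution_def)
  note f1 = C_1_on_Icc[OF this(1)] and u1 = C_1_on_Icc[OF this(2)]
  have "((\<lambda>x. u x * inverse (f x)) has_vector_derivative
      u x * (- ?f' x * (inverse (f x) * inverse (f x))) + ?u' x * inverse (f x)) (at x within {a..b})"
    using x nz by (intro has_vector_derivative_mult has_vector_derivative_inverse_within f1 u1) auto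
  also have "u x * (- ?f' x * (inverse (f x) * inverse (f x))) + ?u' x * inverse (f x) =
      inverse ((f x)\<^sup>2) * w x"
    using x nz by (simp add: w_def field_simps power2_eq_square)
  finally show "(v has_vector_derivative inverse ((f x)\<^sup>2) * w x) (at x within {a..b})"
    by (simp only: v_def divide_inverse)
  have "(w has_vector_derivative lam * (f y * u y)) (at y)" if y: "y \<in> {a<..<b}" for y
  proof -
    have at: "at y within {a..b} = at y"
      using y by (auto simp: at_within_Icc_at)
    have "(w has_vector_derivative
        (?u' y * ?f' y + ((lam - q y) * u y) * f y) -
        (u y * ((0 - q y) * f y) + ?u' y * ?f' y)) (at y)"
      unfolding w_def
      using y f1(3)[of y] u1(3)[of y] unfolding at
      by (intro has_vector_derivative_diff has_vector_derivative_mult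
          is_solution_second_derivative[OF f] is_solution_second_derivative[OF u]) auto
    then show ?thesis
      by (simp add: algebra_simps)
  qed
  then have "(w has_vector_derivative lam * (f x * u x)) (at x within {a..b})"
    unfolding w_def
    by (intro has_vector_derivative_Icc[where G = "\<lambda>x. lam * (f x * u x)"] x
        continuous_intros f1 u1)
  then show "(w has_vector_derivative lam * ((f x)\<^sup>2 * v x)) (at x within {a..b})"
    using x nz by (simp add: v_def power2_eq_square)
qed

section \<open>Derivatives of the quotient\<close>

text \<open>
  In the chain \<open>v, w, \<lambda> v, \<lambda> w, \<dots>\<close> the step from an even to an odd place uses the equation of
  \<open>v'\<close>, and the step from an odd to an even place uses that of \<open>w'\<close> and produces one more factor
  \<open>\<lambda>\<close>.
\<close>

lemma quotient_derivatives:
  fixes a b x0 :: real and q f u :: "real \<Rightarrow> complex" and lam :: complex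
  assumes "a < b" and x0: "x0 \<in> {a..b}"
    and f: "is_solution a b q 0 f" and nz: "\<forall>x\<in>{a..b}. f x \<noteq> 0"
    and n: "has_derivs_upto {a..b} n f x0"
    and u: "is_solution a b q lam u"
  defines "w0 \<equiv> iter_deriv {a..b} 1 u x0 * f x0 - u x0 * iter_deriv {a..b} 1 f x0"
  shows "has_derivs_upto {a..b} n u x0"
    and "has_derivs_upto {a..b} n (\<lambda>x. u x / f x) x0"
    and "deriv_vec {a..b} (\<lambda>x. u x / f x) x0 n =
      A_mat {a..b} f x0 n *\<^sub>v
        vec (n + 1) (\<lambda>k. lam ^ (k div 2) * (if even k then u x0 / f x0 else w0))"
proof -
  interpret no_isolated_points "{a..b}"
    by (rule no_isolated_points_Icc) fact
  define \<phi> where "\<phi> = (\<lambda>x. (f x)\<^sup>2)"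
  define v where "v = (\<lambda>x. u x / f x)"
  define w where "w = (\<lambda>x. iter_deriv {a..b} 1 u x * f x - u x * iter_deriv {a..b} 1 f x)"
  define Z where "Z m x = lam ^ (m div 2) * (if even m then v x else w x)" for m x
  have v': "(v has_vector_derivative inverse (\<phi> x) * w x) (at x within {a..b})"
    and w': "(w has_vector_derivative lam * (\<phi> x * v x)) (at x within {a..b})"
    if "x \<in> {a..b}" for x
    using quotient_wronskian_system[OF f nz u that] by (simp_all add: v_def w_def \<phi>_def)
  have \<phi>: "has_derivs_upto {a..b} n \<phi> x0" and \<phi>_nz: "\<And>x. x \<in> {a..b} \<Longrightarrow> \<phi> x \<noteq> 0"
    using has_derivs_upto_mult[OF x0 n n] nz by (simp_all add: \<phi>_def power2_eq_square)
  show v: "has_derivs_upto {a..b} n (\<lambda>x. u x / f x) x0"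
    using has_derivs_upto_system(1)[OF x0 \<phi>_nz \<phi> v' w'] by (simp add: v_def)
  show "has_derivs_upto {a..b} n u x0"
    using nz by (intro has_derivs_upto_cong[OF _ x0 has_derivs_upto_mult[OF x0 v n]]) simp
  have Z: "(Z m has_vector_derivative \<phi> x powi ((- 1) ^ Suc m) * Z (Suc m) x) (at x within {a..b})"
    if x: "x \<in> {a..b}" for m x
  proof (cases "even m")
    case True
    then have "Z m = (\<lambda>x. lam ^ (m div 2) * v x)"
      and "\<phi> x powi ((- 1) ^ Suc m) * Z (Suc m) x = lam ^ (m div 2) * (inverse (\<phi> x) * w x)"
      by (auto simp: Z_def fun_eq_iff power_int_minus)
    then show ?thesis
      using has_vector_derivative_mult_right[OF v'[OF x]] by simp
  next
    case False
    then have "Z m = (\<lambda>x. lam ^ (m div 2) * w x)"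
      and "\<phi> x powi ((- 1) ^ Suc m) * Z (Suc m) x = lam ^ (m div 2) * (lam * (\<phi> x * v x))"
      by (auto simp: Z_def fun_eq_iff elim!: oddE)
    then show ?thesis
      using has_vector_derivative_mult_right[OF w'[OF x]] by simp
  qed
  have chain: "iter_deriv {a..b} j (Z 0) x0 = (\<Sum>m\<le>n. a_fun {a..b} \<phi> j m x0 * Z m x0)"
    if "j \<le> n" for j
    using x0 \<phi>_nz \<phi> Z that by (rule iter_deriv_chain)
  have "Z 0 = v"
    by (simp add: Z_def fun_eq_iff)
  show "deriv_vec {a..b} (\<lambda>x. u x / f x) x0 n =
      A_mat {a..b} f x0 n *\<^sub>v
        vec (n + 1) (\<lambda>k. lam ^ (k div 2) * (if even k then u x0 / f x0 else w0))"
  proof (rule eq_vecI)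
    fix j
    assume "j < dim_vec (A_mat {a..b} f x0 n *\<^sub>v
        vec (n + 1) (\<lambda>k. lam ^ (k div 2) * (if even k then u x0 / f x0 else w0)))"
    then have j: "j \<le> n"
      by (simp add: A_mat_def)
    have "iter_deriv {a..b} j v x0 = (\<Sum>m\<le>n. a_fun {a..b} \<phi> j m x0 * Z m x0)"
      using chain[OF j] \<open>Z 0 = v\<close> by simp
    also have "\<dots> = (\<Sum>m\<in>{0..<n + 1}. a_fun {a..b} \<phi> j m x0 * Z m x0)"
      by (rule sum.cong) auto
    finally show "deriv_vec {a..b} (\<lambda>x. u x / f x) x0 n $ j =
        (A_mat {a..b} f x0 n *\<^sub>v
          vec (n + 1) (\<lambda>k. lam ^ (k div 2) * (if even k then u x0 / f x0 else w0))) $ j"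
      using j
      by (simp add: deriv_vec_def A_mat_def scalar_prod_def v_def w_def w0_def Z_def \<phi>_def
          cong: if_cong)
  qed (simp add: deriv_vec_def A_mat_def)
qed

theorem theorem15:
  fixes a b x0 :: real and q f u1 u2 :: "real \<Rightarrow> complex" and lam :: complex and n :: nat
  assumes "a < b"
    and "continuous_on {a..b} q"
    and "C_k_on 2 {a<..<b} f" and "C_k_on 1 {a..b} f"
    and "\<forall>x\<in>{a<..<b}. iter_deriv {a<..<b} 2 f x + q x * f x = 0"
    and "\<forall>x\<in>{a..b}. f x \<noteq> 0"
    and "x0 \<in> {a..b}" and "n \<ge> 1"
    and "has_derivs_upto {a..b} n f x0"
    and "is_solution a b q lam u1" and "is_solution a b q lam u2"
    and "\<forall>c1 c2 :: complex. (\<forall>x\<in>{a..b}. c1 * u1 x + c2 * u2 x = 0) \<longrightarrow> c1 = 0 \<and> c2 = 0"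
    and "u1 x0 = f x0" and "iter_deriv {a..b} 1 u1 x0 = iter_deriv {a..b} 1 f x0"
    and "u2 x0 = 0" and "iter_deriv {a..b} 1 u2 x0 = 1 / f x0"
  shows "has_derivs_upto {a..b} n u1 x0 \<and> has_derivs_upto {a..b} n u2 x0 \<and>
    has_derivs_upto {a..b} n (\<lambda>x. u1 x / f x) x0 \<and>
    has_derivs_upto {a..b} n (\<lambda>x. u2 x / f x) x0 \<and>
    deriv_vec {a..b} (\<lambda>x. u1 x / f x) x0 n =
      A_mat {a..b} f x0 n *\<^sub>v vec (n + 1) (\<lambda>k. if even k then lam ^ (k div 2) else 0) \<and>
    deriv_vec {a..b} (\<lambda>x. u2 x / f x) x0 n =
      A_mat {a..b} f x0 n *\<^sub>v vec (n + 1) (\<lambda>k. if odd k then lam ^ ((k - 1) div 2) else 0)"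
proof -
  have f: "is_solution a b q 0 f"
    using assms(3-5) by (simp add: is_solution_def)
  note u1 = quotient_derivatives[OF \<open>a < b\<close> \<open>x0 \<in> {a..b}\<close> f
      \<open>\<forall>x\<in>{a..b}. f x \<noteq> 0\<close> \<open>has_derivs_upto {a..b} n f x0\<close> \<open>is_solution a b q lam u1\<close>]
  note u2 = quotient_derivatives[OF \<open>a < b\<close> \<open>x0 \<in> {a..b}\<close> f
      \<open>\<forall>x\<in>{a..b}. f x \<noteq> 0\<close> \<open>has_derivs_upto {a..b} n f x0\<close> \<open>is_solution a b q lam u2\<close>]
  have "f x0 \<noteq> 0"
    using \<open>x0 \<in> {a..b}\<close> \<open>\<forall>x\<in>{a..b}. f x \<noteq> 0\<close> by blast
  have "(\<lambda>k. lam ^ (k div 2) * (if even k then u1 x0 / f x0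
        else iter_deriv {a..b} 1 u1 x0 * f x0 - u1 x0 * iter_deriv {a..b} 1 f x0)) =
      (\<lambda>k. if even k then lam ^ (k div 2) else 0)"
    using \<open>f x0 \<noteq> 0\<close> unfolding assms(13-16) by (simp add: fun_eq_iff)
  moreover have "(\<lambda>k. lam ^ (k div 2) * (if even k then u2 x0 / f x0
        else iter_deriv {a..b} 1 u2 x0 * f x0 - u2 x0 * iter_deriv {a..b} 1 f x0)) =
      (\<lambda>k. if odd k then lam ^ ((k - 1) div 2) else 0)"
    using \<open>f x0 \<noteq> 0\<close> unfolding assms(13-16) by (auto simp: fun_eq_iff elim!: oddE)
  ultimately show ?thesis
    using u1 u2 by (simp only: simp_thms)
qed

end
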